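(* Let $(a_n)_{n \ge 0}$ be the sequence of rational numbers defined by $a_0 = 0$ and $a_n = \frac{n}{2} a_{n-1} + (n-1)!$ for all $n \geq 1$. Then for every natural number $n$, $$a_n = (-1)^{n-1} \sum_{k=0}^{n} G_k\, s(n,k),$$ where $G_k$ are the Genocchi numbers and $s(n,k)$ are the Stirling numbers of the first kind.
   Context: The Stirling numbers of the first kind $s(n,k)$ ($0 \le k \le n$) are the (signed) integers defined by the polynomial identity $X(X-1)\cdots(X-n+1) = \sum_{k=0}^{n} s(n,k) X^k$. The Genocchi numbers $G_n$ ($n \ge 0$) are defined by the exponential generating function $\frac{2x}{e^x+1} = \sum_{n=0}^{\infty} G_n \frac{x^n}{n!}$. *)

theory Defs
  imports Complex_Main "HOL-Computational_Algebra.Polynomial"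
    "HOL-Computational_Algebra.Formal_Power_Series"
begin

text \<open>The library constant \<open>stirling\<close> is the unsigned version; this is the signed one, read off
  from the falling factorial \<open>X (X - 1) \<dots> (X - n + 1)\<close>.\<close>

definition signed_stirling1 :: "nat \<Rightarrow> nat \<Rightarrow> int" where
  "signed_stirling1 n k = coeff (\<Prod>i<n. [:- int i, 1:]) k"

definition genocchi :: "nat \<Rightarrow> rat" where
  "genocchi n = fact n * fps_nth (2 * fps_X / (fps_exp 1 + 1)) n"

lemma falling_factorial_eq_sum_signed_stirling1:
  "(\<Prod>i<n. [:- int i, 1:]) = (\<Sum>k\<le>n. monom (signed_stirling1 n k) k)"
proof -
  have "degree (\<Prod>i<n. [:- int i, 1:]) \<le> (\<Sum>i<n. degree [:- int i, 1:])"
    by (rule degree_prod_sum_le[unfolded comp_def]) simp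
  then have "degree (\<Prod>i<n. [:- int i, 1:]) \<le> n"
    by simp
  from poly_as_sum_of_monoms'[OF this] show ?thesis
    by (simp add: signed_stirling1_def)
qed

lemma genocchi_egf:
  "Abs_fps (\<lambda>n. genocchi n / fact n) * (fps_exp 1 + 1) = 2 * fps_X"
proof -
  let ?e = "fps_exp 1 + 1 :: rat fps"
  have "fps_nth ?e 0 \<noteq> 0" by simp
  then have "inverse ?e * ?e = 1" by (rule inverse_mult_eq_1)
  moreover have "Abs_fps (\<lambda>n. genocchi n / fact n) = 2 * fps_X * inverse ?e"
    using fps_divide_unit[OF \<open>fps_nth ?e 0 \<noteq> 0\<close>]
    by (simp add: fps_eq_iff genocchi_def)
  ultimately show ?thesis by (simp add: mult.assoc)
qed

end

(* Umbral proof. Let L be the linear functional on polynomials with L(X^k) = G_k. The generating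
   function identity G(x) (e^x + 1) = 2x says L(p(X+1)) + L(p(X)) = 2 p'(0) for every p.
   Taking p = X(X-1)...(X-n), for which p(X+1) = p(X) + (n+1) X(X-1)...(X-n+1), yields
   2 L((X)_{n+1}) + (n+1) L((X)_n) = 2 (-1)^n n!, which is the recurrence for a up to sign. *)

theory Submission
  imports Defs
begin

text \<open>Compare the coefficients of x^n in G(x) (e^x + 1) = 2x and multiply by n!.\<close>

lemma sum_binomial_genocchi:
  "(\<Sum>k\<le>n. of_nat (n choose k) * genocchi k) + genocchi n = (if n = 1 then 2 else 0)"
proof -
  have "fps_nth (Abs_fps (\<lambda>n. genocchi n / fact n) * (fps_exp 1 + 1)) n
      = fps_nth (2 * fps_X :: rat fps) n"
    by (simp only: genocchi_egf)
  then have "(\<Sum>k\<le>n. genocchi k / fact k * (1 / fact (n - k))) + genocchi n / fact n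
      = (if n = 1 then 2 else 0)"
    by (simp add: distrib_left numeral_fps_const fps_mult_nth[of _ "fps_exp 1"] atLeast0AtMost)
  then have "fact n * ((\<Sum>k\<le>n. genocchi k / fact k * (1 / fact (n - k))) + genocchi n / fact n)
      = fact n * (if n = 1 then 2 else 0)"
    by (rule arg_cong)
  moreover have "fact n * (\<Sum>k\<le>n. genocchi k / fact k * (1 / fact (n - k)))
      = (\<Sum>k\<le>n. of_nat (n choose k) * genocchi k)"
    unfolding sum_distrib_left
    by (intro sum.cong refl) (simp add: binomial_fact)
  ultimately show ?thesis
    by (simp add: distrib_left split: if_splits)
qed

definition genocchi_umbral :: "int poly \<Rightarrow> rat" where
  "genocchi_umbral p = (\<Sum>k\<le>degree p. of_int (coeff p k) * genocchi k)"

text \<open>Coefficients above the degree vanish. Polynomials of different degrees can thus be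
  summed over one common range, which is how additivity is obtained.\<close>

lemma genocchi_umbral_eq:
  assumes "degree p \<le> N"
  shows "genocchi_umbral p = (\<Sum>k\<le>N. of_int (coeff p k) * genocchi k)"
  unfolding genocchi_umbral_def
  using assms by (intro sum.mono_neutral_left) (auto simp: coeff_eq_0)

lemma genocchi_umbral_0 [simp]: "genocchi_umbral 0 = 0"
  by (simp add: genocchi_umbral_def)

lemma genocchi_umbral_add: "genocchi_umbral (p + q) = genocchi_umbral p + genocchi_umbral q"
proof -
  let ?N = "max (degree p) (degree q)"
  have "degree (p + q) \<le> ?N" by (rule degree_add_le_max)
  then show ?thesis
    by (simp add: genocchi_umbral_eq[of _ ?N] algebra_simps sum.distrib)
qed

lemma genocchi_umbral_smult: "genocchi_umbral (smult c p) = of_int c * genocchi_umbral p"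
  by (simp add: genocchi_umbral_eq[of "smult c p" "degree p"] degree_smult_le
      genocchi_umbral_def sum_distrib_left mult.assoc)

lemma genocchi_umbral_sum: "genocchi_umbral (sum f A) = (\<Sum>x\<in>A. genocchi_umbral (f x))"
  by (induction A rule: infinite_finite_induct) (simp_all add: genocchi_umbral_add)

lemma pcompose_power: "pcompose (p ^ n) q = pcompose p q ^ n"
  for p q :: "'a::comm_semiring_1 poly"
  by (induction n) (simp_all add: pcompose_1 pcompose_mult)

text \<open>Both sides are linear in \<open>p\<close>, so powers of X suffice. There the binomial
  expansion of (X + 1)^k turns the claim into \<open>sum_binomial_genocchi\<close>.\<close>

lemma genocchi_umbral_shift:
  "genocchi_umbral (pcompose p [:1, 1:]) + genocchi_umbral p = 2 * of_int (coeff p 1)"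
proof -
  have power: "genocchi_umbral ([:1, 1:] ^ k) + genocchi_umbral ([:0, 1:] ^ k)
      = (if k = 1 then 2 else 0)" for k
  proof -
    have "genocchi_umbral ([:1, 1:] ^ k) = (\<Sum>j\<le>k. of_nat (k choose j) * genocchi j)"
      by (simp add: genocchi_umbral_def degree_linear_power coeff_linear_poly_power)
    moreover have "genocchi_umbral ([:0, 1:] ^ k) = (\<Sum>j\<le>k. if j = k then genocchi j else 0)"
      unfolding genocchi_umbral_def degree_linear_power
      by (intro sum.cong refl) (simp add: coeff_linear_poly_power)
    ultimately show ?thesis
      using sum_binomial_genocchi[of k] by simp
  qed
  \<comment> \<open>The bound is at least 1 so that the index k = 1, the only one that contributes
    in the end, lies in the range even for constant \<open>p\<close>.\<close>
  let ?N = "max 1 (degree p)"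
  have p: "p = (\<Sum>k\<le>?N. smult (coeff p k) ([:0, 1:] ^ k))"
    using poly_as_sum_of_monoms'[of p ?N] by (simp add: monom_altdef)
  have "pcompose p [:1, 1:] = pcompose (\<Sum>k\<le>?N. smult (coeff p k) ([:0, 1:] ^ k)) [:1, 1:]"
    using p by (rule arg_cong)
  also have "\<dots> = (\<Sum>k\<le>?N. smult (coeff p k) ([:1, 1:] ^ k))"
    by (simp add: pcompose_sum pcompose_smult pcompose_power pcompose_pCons)
  finally have "genocchi_umbral (pcompose p [:1, 1:])
      = (\<Sum>k\<le>?N. of_int (coeff p k) * genocchi_umbral ([:1, 1:] ^ k))"
    by (simp only: genocchi_umbral_sum genocchi_umbral_smult)
  moreover have "genocchi_umbral p
      = (\<Sum>k\<le>?N. of_int (coeff p k) * genocchi_umbral ([:0, 1:] ^ k))"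
    using arg_cong[OF p, of genocchi_umbral]
    by (simp only: genocchi_umbral_sum genocchi_umbral_smult)
  ultimately have "genocchi_umbral (pcompose p [:1, 1:]) + genocchi_umbral p
      = (\<Sum>k\<le>?N. of_int (coeff p k) *
          (genocchi_umbral ([:1, 1:] ^ k) + genocchi_umbral ([:0, 1:] ^ k)))"
    by (simp only: distrib_left sum.distrib)
  also have "\<dots> = (\<Sum>k\<le>?N. if k = 1 then 2 * of_int (coeff p 1) else 0)"
    by (intro sum.cong refl) (simp add: power)
  finally show ?thesis
    by simp
qed

definition falling_factorial :: "nat \<Rightarrow> int poly" where
  "falling_factorial n = (\<Prod>i<n. [:- int i, 1:])"

lemma genocchi_umbral_falling_factorial:
  "genocchi_umbral (falling_factorial n)
    = (\<Sum>k=0..n. genocchi k * of_int (signed_stirling1 n k))"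
proof -
  have "degree (falling_factorial n) \<le> (\<Sum>i<n. degree [:- int i, 1:])"
    unfolding falling_factorial_def by (rule degree_prod_sum_le[unfolded comp_def]) simp
  then show ?thesis
    by (simp add: genocchi_umbral_eq[of _ n] falling_factorial_def signed_stirling1_def
        atLeast0AtMost mult.commute)
qed

text \<open>The shift turns each factor X - i into X - (i - 1): the factor i = 0 becomes X + 1 and
  the others form \<open>falling_factorial n\<close>. Then split X + 1 = (X - n) + (n + 1).\<close>

lemma falling_factorial_shift:
  "pcompose (falling_factorial (Suc n)) [:1, 1:]
    = falling_factorial (Suc n) + smult (int (Suc n)) (falling_factorial n)"
proof -
  have "pcompose (falling_factorial (Suc n)) [:1, 1:] = [:1, 1:] * falling_factorial n"
    unfolding falling_factorial_def prod.lessThan_Suc_shift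
    by (simp add: pcompose_mult pcompose_prod pcompose_pCons)
  also have "[:1, 1:] = [:- int n, 1:] + [:int (Suc n):]"
    by simp
  finally show ?thesis
    unfolding distrib_right by (simp add: falling_factorial_def mult.commute)
qed

lemma coeff_1_falling_factorial: "coeff (falling_factorial (Suc n)) 1 = (-1) ^ n * fact n"
proof -
  have "falling_factorial (Suc n) = pCons 0 (\<Prod>i<n. [:- int (Suc i), 1:])"
    unfolding falling_factorial_def prod.lessThan_Suc_shift by simp
  then have "coeff (falling_factorial (Suc n)) 1 = (\<Prod>i<n. - int (Suc i))"
    \<comment> \<open>The constant term is read as the value at 0, since evaluation commutes with
      products.\<close>
    by (simp flip: poly_0_coeff_0 add: poly_prod)
  also have "\<dots> = (-1) ^ n * fact n"
    by (induction n) (simp_all add: algebra_simps)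
  finally show ?thesis .
qed

text \<open>The falling factorial of index n + 1 occurs both in its own shift and as the unshifted
  term, hence the factor 2.\<close>

lemma genocchi_umbral_falling_factorial_Suc:
  "2 * genocchi_umbral (falling_factorial (Suc n))
    + of_nat (Suc n) * genocchi_umbral (falling_factorial n) = 2 * (-1) ^ n * fact n"
  using genocchi_umbral_shift[of "falling_factorial (Suc n)"]
  unfolding falling_factorial_shift coeff_1_falling_factorial
  by (simp add: genocchi_umbral_add genocchi_umbral_smult)

theorem theorem1:
  fixes a :: "nat \<Rightarrow> rat" and n :: nat
  assumes "a 0 = 0"
    and "\<And>m. m \<ge> 1 \<Longrightarrow> a m = of_nat m / 2 * a (m - 1) + fact (m - 1)"
  shows "a n = (-1) powi (int n - 1) * (\<Sum>k=0..n. genocchi k * of_int (signed_stirling1 n k))"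
proof -
  \<comment> \<open>The sign (-1)^(n-1) is written as -(-1)^n, which keeps the exponent natural at n
    = 0.\<close>
  have "genocchi_umbral (falling_factorial n) = - ((-1) ^ n * a n)"
  proof (induction n)
    case 0
    have "genocchi 0 = 0"
      using sum_binomial_genocchi[of 0] by simp
    then show ?case
      by (simp add: assms(1) falling_factorial_def genocchi_umbral_def)
  next
    case (Suc n)
    have "a (Suc n) = of_nat (Suc n) / 2 * a n + fact n"
      using assms(2)[of "Suc n"] by simp
    \<comment> \<open>The recurrence for \<open>a\<close>, multiplied by 2 (-1)^n, is the same
      linear equation that the umbral values satisfy, and it determines the next value from the
      previous one.\<close>
    then have "2 * (- ((-1) ^ Suc n * a (Suc n))) + of_nat (Suc n) * (- ((-1) ^ n * a n))
        = 2 * (-1) ^ n * fact n"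
      by (simp add: algebra_simps add_divide_distrib diff_divide_distrib)
    then show ?case
      using genocchi_umbral_falling_factorial_Suc[of n] unfolding Suc.IH by linarith
  qed
  moreover have "(-1) powi (int n - 1) = - ((-1) ^ n :: rat)"
    by (simp add: power_int_diff)
  ultimately show ?thesis
    \<comment> \<open>The two signs merge into ((-1) (-1))^n = 1.\<close>
    by (simp flip: genocchi_umbral_falling_factorial power_mult_distrib
        add: mult.assoc[symmetric])
qed

end
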